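(* If $k\geq3$ and $n\geq 2$ then there exists an $\mathcal{OS}_k(n+1)$ (a $k$-ary orientable sequence of order $n+1$) with period \[ k\,\frac{k^n-r_{k,n,nk/2}}{2}. \]
   Context: Sequences. For an infinite periodic sequence $S=(s_i)$ with elements in $\mathbb{Z}_k$ and $t\ge 2$, write $\mathbf{s}_t(i)=(s_i,s_{i+1},\ldots,s_{i+t-1})$. For a tuple $\mathbf{u}=(u_0,\ldots,u_{t-1})$ its reverse is $\mathbf{u}^R=(u_{t-1},\ldots,u_0)$. $S$, of period $m$, is a $k$-ary $t$-window sequence if $\mathbf{s}_t(i)=\mathbf{s}_t(j)$ implies $i\equiv j \pmod m$. A $k$-ary $t$-window sequence $S$ is an orientable sequence of order $t$, an $\mathcal{OS}_k(t)$, if $\mathbf{s}_t(i)\neq \mathbf{s}_t(j)^R$ for all $i,j$ (including $i=j$). Pseudoweight. Define $f:\mathbb{Z}_k\to\mathbb{Q}$ by regarding $u\in\mathbb{Z}_k$ as an integer in $[0,k-1]$ and setting $f(u)=u$ if $u\ne 0$ and $f(0)=k/2$. The pseudoweight of $\mathbf{u}=(u_0,\ldots,u_{n-1})\in\mathbb{Z}_k^n$ is $w^*(\mathbf{u})=\sum_{i=0}^{n-1} f(u_i)$, computed in $\mathbb{Q}$. $r_{k,n,s}$ denotes the number of $k$-ary $n$-tuples with pseudoweight exactly $s$ (so $r_{k,n,s}=0$ if $s<n$ or $s>n(k-1)$). *)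

theory Defs
  imports Complex_Main "HOL-Number_Theory.Cong"
begin

text \<open>Elements of \<open>\<int>\<^sub>k\<close> are represented by their residues in \<open>{..<k}\<close>, tuples by lists,
  and infinite sequences are indexed by \<^typ>\<open>nat\<close>.\<close>

definition tuples :: "nat \<Rightarrow> nat \<Rightarrow> nat list set" where
  "tuples k n = {u. length u = n \<and> set u \<subseteq> {..<k}}"

definition window :: "(nat \<Rightarrow> nat) \<Rightarrow> nat \<Rightarrow> nat \<Rightarrow> nat list" where
  "window S t i = map S [i..<i + t]"

text \<open>Minimality of the period \<open>m\<close> is not required here; it follows for window sequences,
  see \<open>window_sequence_period_dvd\<close>.\<close>

definition periodic_seq :: "nat \<Rightarrow> (nat \<Rightarrow> nat) \<Rightarrow> nat \<Rightarrow> bool" where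
  "periodic_seq k S m \<longleftrightarrow> (\<forall>i. S i < k) \<and> m > 0 \<and> (\<forall>i. S (i + m) = S i)"

definition window_sequence :: "nat \<Rightarrow> nat \<Rightarrow> (nat \<Rightarrow> nat) \<Rightarrow> nat \<Rightarrow> bool" where
  "window_sequence k t S m \<longleftrightarrow> t \<ge> 2 \<and> periodic_seq k S m \<and>
     (\<forall>i j. window S t i = window S t j \<longrightarrow> [i = j] (mod m))"

definition orientable_sequence :: "nat \<Rightarrow> nat \<Rightarrow> (nat \<Rightarrow> nat) \<Rightarrow> nat \<Rightarrow> bool" where
  "orientable_sequence k t S m \<longleftrightarrow> window_sequence k t S m \<and>
     (\<forall>i j. window S t i \<noteq> rev (window S t j))"

definition pseudoval :: "nat \<Rightarrow> nat \<Rightarrow> rat" where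
  "pseudoval k u = (if u = 0 then of_nat k / 2 else of_nat u)"

definition pseudoweight :: "nat \<Rightarrow> nat list \<Rightarrow> rat" where
  "pseudoweight k u = (\<Sum>x\<leftarrow>u. pseudoval k x)"

definition pseudoweight_count :: "nat \<Rightarrow> nat \<Rightarrow> rat \<Rightarrow> nat" where
  "pseudoweight_count k n s = card {u \<in> tuples k n. pseudoweight k u = s}"

lemma window_sequence_period_dvd:
  assumes "window_sequence k t S m" and "\<And>i. S (i + p) = S i"
  shows "m dvd p"
proof -
  have "window S t p = window S t 0"
    using assms(2) by (auto simp: window_def list_eq_iff_nth_eq add.commute)
  then have "[p = 0] (mod m)"
    using assms(1) by (auto simp: window_sequence_def)
  then show ?thesis by (simp add: cong_0_iff)
qed

end

theory Submission
  imports Defs "Graph_Theory.Euler"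
begin

text \<open>
  Reversing a tuple over \<open>\<int>\<^sub>k\<close> reverses and negates the tuple of its consecutive differences, and
  negation sends the pseudoweight \<open>w\<close> of an \<open>n\<close>-tuple to \<open>nk - w\<close>: the value \<open>k/2\<close> assigned to
  zero makes this hold in every coordinate. Call an \<open>n\<close>-tuple light if its pseudoweight is below
  \<open>nk/2\<close>. Then the set of \<open>(n+1)\<close>-tuples with light differences contains no tuple together with its
  reverse (\<open>rev_notin_light_arcs\<close>). A periodic sequence whose windows are exactly these tuples, each
  occurring once per period, is therefore orientable. Negation pairs light tuples with those of
  pseudoweight above \<open>nk/2\<close>, which leaves \<open>(k^n - r)/2\<close> light tuples, where \<open>r\<close> counts the tuples
  of pseudoweight \<open>nk/2\<close>; an \<open>(n+1)\<close>-tuple is determined by its first entry and its differences, whence the factor \<open>k\<close>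
  (\<open>card_light_arcs\<close>, \<open>card_light_tuples\<close>).

  Such a sequence is an Eulerian circuit in the subgraph of the de Bruijn graph whose arcs are the
  \<open>(n+1)\<close>-tuples with light differences (\<open>window_sequence_from_euler\<close>). Two properties
  give the circuit. In-degree equals out-degree (\<open>light_arcs_balanced\<close>), because the pseudoweight of
  a difference tuple does not depend on whether a given difference is put at the front or at the
  back. The graph is connected (\<open>light_arcs_connected\<close>), because for \<open>k \<ge> 3\<close> the value \<open>1\<close> has the
  least pseudoweight: from any vertex one may append the successor of the last entry again and
  again without leaving the graph. After a while all differences are \<open>1\<close>, and the walk then runs
  through a single cycle that is the same for all starting points.

  The circuit is taken in the graph of \<open>(n+1)\<close>-tuples itself, not in the smaller graph of light
  \<open>n\<close>-tuples: lifting a circuit of the smaller graph through the difference map would multiply its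
  period by \<open>k\<close> only if its sum were coprime to \<open>k\<close>.
\<close>

section \<open>Difference tuples\<close>

definition diff_mod :: "nat \<Rightarrow> nat \<Rightarrow> nat \<Rightarrow> nat" where
  "diff_mod k a b = (b + k - a) mod k"

fun differences :: "nat \<Rightarrow> nat list \<Rightarrow> nat list" where
  "differences k (x # y # ys) = diff_mod k x y # differences k (y # ys)"
| "differences k _ = []"

fun partial_sums :: "nat \<Rightarrow> nat \<Rightarrow> nat list \<Rightarrow> nat list" where
  "partial_sums k a [] = [a]"
| "partial_sums k a (d # ds) = a # partial_sums k ((a + d) mod k) ds"

lemma diff_mod_less: "0 < k \<Longrightarrow> diff_mod k a b < k"
  by (simp add: diff_mod_def)

lemma diff_mod_cases:
  assumes "a < k" "b < k"
  shows "diff_mod k a b = (if a \<le> b then b - a else b + k - a)"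
proof (cases "a \<le> b")
  case True
  then have "diff_mod k a b = ((b - a) + k) mod k" by (simp add: diff_mod_def)
  with assms True show ?thesis by (simp only: mod_add_self2) simp
next
  case False
  with assms show ?thesis by (simp add: diff_mod_def)
qed

lemma add_mod_cases:
  fixes a d k :: nat
  assumes "a < k" "d < k"
  shows "(a + d) mod k = (if a + d < k then a + d else a + d - k)"
  using assms by (simp add: le_mod_geq)

lemma diff_mod_add: "a < k \<Longrightarrow> d < k \<Longrightarrow> diff_mod k a ((a + d) mod k) = d"
  by (subst diff_mod_cases) (auto simp: add_mod_cases)

lemma add_diff_mod: "a < k \<Longrightarrow> b < k \<Longrightarrow> (a + diff_mod k a b) mod k = b"
  by (auto simp: diff_mod_cases)

text \<open>For fixed \<open>b\<close> the map \<open>a \<mapsto> b - a\<close> is an involution, hence a bijection of \<open>\<int>\<^sub>k\<close>.\<close>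

lemma diff_mod_diff_mod: "a < k \<Longrightarrow> b < k \<Longrightarrow> diff_mod k (diff_mod k a b) b = a"
  by (subst diff_mod_cases) (auto simp: diff_mod_cases)

lemma diff_mod_swap: "a < k \<Longrightarrow> b < k \<Longrightarrow> diff_mod k b a = (k - diff_mod k a b) mod k"
  by (auto simp: diff_mod_cases)

lemma diff_mod_Suc: "a < k \<Longrightarrow> 2 \<le> k \<Longrightarrow> diff_mod k a (Suc a mod k) = 1"
  using diff_mod_add[of a k 1] by simp

lemma bij_betw_diff_mod_left:
  assumes "b < k" shows "bij_betw (\<lambda>a. diff_mod k a b) {..<k} {..<k}"
  using assms
  by (intro bij_betw_byWitness[where f' = "\<lambda>a. diff_mod k a b"])
     (auto simp: diff_mod_diff_mod diff_mod_less)

lemma bij_betw_diff_mod_right: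
  assumes "a < k" shows "bij_betw (diff_mod k a) {..<k} {..<k}"
  using assms
  by (intro bij_betw_byWitness[where f' = "\<lambda>d. (a + d) mod k"])
     (auto simp: diff_mod_add add_diff_mod diff_mod_less)

lemma differences_Cons:
  "ys \<noteq> [] \<Longrightarrow> differences k (x # ys) = diff_mod k x (hd ys) # differences k ys"
  by (cases ys) auto

lemma differences_snoc:
  "ys \<noteq> [] \<Longrightarrow> differences k (ys @ [x]) = differences k ys @ [diff_mod k (last ys) x]"
  by (induction k ys rule: differences.induct) auto

lemma differences_rev:
  assumes "set xs \<subseteq> {..<k}"
  shows "differences k (rev xs) = map (\<lambda>d. (k - d) mod k) (rev (differences k xs))"
  using assms
proof (induction k xs rule: differences.induct)
  case (1 k x y ys)
  have "differences k (rev (x # y # ys)) = differences k (rev (y # ys)) @ [diff_mod k y x]"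
    using differences_snoc[of "rev (y # ys)" k x] by simp
  then show ?case
    using 1 by (simp add: diff_mod_swap[of x k y])
qed auto

lemma hd_tuple_less: "v \<in> tuples k n \<Longrightarrow> 0 < n \<Longrightarrow> hd v < k"
  by (cases v) (auto simp: tuples_def)

lemma last_tuple_less: "v \<in> tuples k n \<Longrightarrow> 0 < n \<Longrightarrow> last v < k"
  by (cases v rule: rev_cases) (auto simp: tuples_def)

lemma tl_in_tuples: "x \<in> tuples k (Suc n) \<Longrightarrow> tl x \<in> tuples k n"
  by (cases x) (auto simp: tuples_def)

lemma butlast_in_tuples: "x \<in> tuples k (Suc n) \<Longrightarrow> butlast x \<in> tuples k n"
  by (cases x rule: rev_cases) (auto simp: tuples_def)

lemma differences_in_tuples:
  "x \<in> tuples k (Suc n) \<Longrightarrow> differences k x \<in> tuples k n"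
proof (induction n arbitrary: x)
  case 0
  then show ?case by (cases x) (auto simp: tuples_def)
next
  case (Suc n)
  then obtain a y where x: "x = a # y" and y: "y \<in> tuples k (Suc n)" and a: "a < k"
    by (cases x) (auto simp: tuples_def)
  then have "differences k x = diff_mod k a (hd y) # differences k y"
    by (subst x, intro differences_Cons) (auto simp: tuples_def)
  then show ?case
    using Suc.IH[OF y] a by (auto simp: tuples_def diff_mod_less)
qed

lemma partial_sums_in_tuples:
  "a < k \<Longrightarrow> u \<in> tuples k n \<Longrightarrow> partial_sums k a u \<in> tuples k (Suc n)"
  by (induction k a u arbitrary: n rule: partial_sums.induct) (force simp: tuples_def)+

lemma hd_partial_sums [simp]: "hd (partial_sums k a u) = a"
  by (cases u) auto

lemma differences_partial_sums:
  "a < k \<Longrightarrow> set u \<subseteq> {..<k} \<Longrightarrow> differences k (partial_sums k a u) = u"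
proof (induction k a u rule: partial_sums.induct)
  case (2 k a d ds)
  have "partial_sums k ((a + d) mod k) ds \<noteq> []" by (cases ds) auto
  with 2 show ?case by (auto simp: differences_Cons diff_mod_add)
qed auto

lemma partial_sums_differences:
  "x \<noteq> [] \<Longrightarrow> set x \<subseteq> {..<k} \<Longrightarrow> partial_sums k (hd x) (differences k x) = x"
  by (induction k x rule: differences.induct) (auto simp: add_diff_mod)

text \<open>The first entry and the differences determine a tuple through its partial sums, and both can be
  prescribed freely.\<close>

lemma card_tuples_differences:
  "card {x \<in> tuples k (Suc n). P (differences k x)} = k * card {u \<in> tuples k n. P u}"
proof -
  have "bij_betw (\<lambda>x. (hd x, differences k x)) {x \<in> tuples k (Suc n). P (differences k x)}
          ({..<k} \<times> {u \<in> tuples k n. P u})"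
  proof (rule bij_betw_byWitness[where f' = "\<lambda>(a, u). partial_sums k a u"])
    show "\<forall>x \<in> {x \<in> tuples k (Suc n). P (differences k x)}.
        (case (hd x, differences k x) of (a, u) \<Rightarrow> partial_sums k a u) = x"
      by (auto simp: tuples_def intro!: partial_sums_differences)
    show "\<forall>z \<in> {..<k} \<times> {u \<in> tuples k n. P u}.
        (hd (case z of (a, u) \<Rightarrow> partial_sums k a u),
         differences k (case z of (a, u) \<Rightarrow> partial_sums k a u)) = z"
      by (auto simp: tuples_def differences_partial_sums)
    show "(\<lambda>x. (hd x, differences k x)) ` {x \<in> tuples k (Suc n). P (differences k x)}
        \<subseteq> {..<k} \<times> {u \<in> tuples k n. P u}"
      by (auto intro: differences_in_tuples hd_tuple_less)
    show "(\<lambda>(a, u). partial_sums k a u) ` ({..<k} \<times> {u \<in> tuples k n. P u})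
        \<subseteq> {x \<in> tuples k (Suc n). P (differences k x)}"
      using differences_partial_sums by (auto intro: partial_sums_in_tuples) (simp add: tuples_def)
  qed
  then show ?thesis by (simp add: bij_betw_same_card card_cartesian_product)
qed

section \<open>Pseudoweight and negation\<close>

lemma pseudoweight_Nil [simp]: "pseudoweight k [] = 0"
  and pseudoweight_Cons [simp]: "pseudoweight k (x # u) = pseudoval k x + pseudoweight k u"
  and pseudoweight_append [simp]: "pseudoweight k (u @ v) = pseudoweight k u + pseudoweight k v"
  and pseudoweight_rev [simp]: "pseudoweight k (rev u) = pseudoweight k u"
  by (simp_all add: pseudoweight_def rev_map[symmetric] sum_list_rev)

lemma pseudoval_1_le: "2 \<le> k \<Longrightarrow> pseudoval k 1 \<le> pseudoval k x"
  by (auto simp: pseudoval_def)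

lemma pseudoval_neg: "x < k \<Longrightarrow> pseudoval k ((k - x) mod k) = of_nat k - pseudoval k x"
  by (auto simp: pseudoval_def of_nat_diff)

lemma pseudoweight_neg:
  "set u \<subseteq> {..<k} \<Longrightarrow>
    pseudoweight k (map (\<lambda>x. (k - x) mod k) u) = of_nat (length u) * of_nat k - pseudoweight k u"
  by (induction u) (auto simp: pseudoval_neg algebra_simps)

lemma finite_tuples: "finite (tuples k n)"
  using finite_lists_length_eq[of "{..<k}" n] by (simp add: tuples_def conj_commute)

lemma card_tuples: "card (tuples k n) = k ^ n"
  using card_lists_length_eq[of "{..<k}" n] by (simp add: tuples_def conj_commute)

definition light_tuples :: "nat \<Rightarrow> nat \<Rightarrow> nat list set" where
  "light_tuples k n = {u \<in> tuples k n. pseudoweight k u < of_nat n * of_nat k / 2}"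

text \<open>Negation is an involution on tuples which reflects the pseudoweight at \<open>nk/2\<close>, so below and above
  this value there are equally many tuples.\<close>

lemma card_light_tuples:
  "2 * card (light_tuples k n) + pseudoweight_count k n (of_nat n * of_nat k / 2) = k ^ n"
proof -
  let ?h = "of_nat n * of_nat k / 2 :: rat"
  let ?neg = "map (\<lambda>x. (k - x) mod k)"
  define M H where "M = {u \<in> tuples k n. pseudoweight k u = ?h}"
    and "H = {u \<in> tuples k n. pseudoweight k u > ?h}"
  have neg_tuples: "?neg u \<in> tuples k n" if "u \<in> tuples k n" for u
    using that by (cases "k = 0") (auto simp: tuples_def)
  have neg_neg: "?neg (?neg u) = u" if "u \<in> tuples k n" for u
  proof -
    have "(k - (k - x) mod k) mod k = x" if "x < k" for x
      using that by (cases "x = 0") auto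
    then show ?thesis
      using that by (auto simp: tuples_def intro!: map_idI)
  qed
  have weight: "pseudoweight k (?neg u) = 2 * ?h - pseudoweight k u" if "u \<in> tuples k n" for u
    using that by (auto simp: tuples_def pseudoweight_neg)
  have "bij_betw ?neg (light_tuples k n) H"
    by (rule bij_betw_byWitness[where f' = ?neg])
       (auto simp: light_tuples_def H_def neg_tuples neg_neg weight mult.commute simp del: map_map)
  then have "card H = card (light_tuples k n)"
    by (simp add: bij_betw_same_card)
  moreover have "tuples k n = light_tuples k n \<union> M \<union> H"
    by (auto simp: light_tuples_def M_def H_def)
  moreover have "card (light_tuples k n \<union> M \<union> H)
      = card (light_tuples k n) + card M + card H"
  proof -
    have "finite (light_tuples k n)" "finite M" "finite H"
      using finite_tuples by (auto simp: light_tuples_def M_def H_def)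
    moreover have "light_tuples k n \<inter> M = {}" "(light_tuples k n \<union> M) \<inter> H = {}"
      by (auto simp: light_tuples_def M_def H_def)
    ultimately show ?thesis by (simp add: card_Un_disjoint)
  qed
  ultimately show ?thesis
    by (simp add: card_tuples M_def pseudoweight_count_def)
qed

section \<open>Eulerian circuits in subgraphs of the de Bruijn graph\<close>

text \<open>Only the end points of arcs in \<open>A\<close> are vertices. The other tuples would be isolated vertices and
  would destroy connectedness.\<close>

definition de_bruijn :: "'a list set \<Rightarrow> ('a list, 'a list) pre_digraph" where
  "de_bruijn A = \<lparr>verts = butlast ` A \<union> tl ` A, arcs = A, tail = butlast, head = tl\<rparr>"

lemma de_bruijn_simps [simp]:
  "verts (de_bruijn A) = butlast ` A \<union> tl ` A" "arcs (de_bruijn A) = A"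
  "tail (de_bruijn A) = butlast" "head (de_bruijn A) = tl"
  by (simp_all add: de_bruijn_def)

lemma fin_digraph_de_bruijn: "finite A \<Longrightarrow> fin_digraph (de_bruijn A)"
  by unfold_locales auto

lemma (in pre_digraph) cas_nth:
  "cas u p v \<Longrightarrow> Suc i < length p \<Longrightarrow> head G (p ! i) = tail G (p ! Suc i)"
proof (induction p arbitrary: u i)
  case (Cons e p)
  then show ?case by (cases p; cases i) auto
qed auto

lemma (in pre_digraph) cas_hd_last:
  "cas u p v \<Longrightarrow> p \<noteq> [] \<Longrightarrow> tail G (hd p) = u \<and> head G (last p) = v"
  by (induction p arbitrary: u) auto

text \<open>The first entries of the arcs of an Eulerian circuit, read cyclically, form a sequence whose
  windows are the arcs again, since consecutive arcs overlap in all but one entry. The arcs of the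
  circuit are distinct, so a window determines its position in the period.\<close>

lemma window_sequence_from_euler:
  assumes A: "A \<subseteq> tuples k (n + 1)" "A \<noteq> {}" and n: "0 < n"
    and conn: "connected (de_bruijn A)"
    and bal: "\<And>v. card {x \<in> A. tl x = v} = card {x \<in> A. butlast x = v}"
  shows "\<exists>S. window_sequence k (n + 1) S (card A) \<and> range (window S (n + 1)) \<subseteq> A"
proof -
  have fin: "finite A" using A(1) finite_tuples finite_subset by blast
  interpret fin_digraph "de_bruijn A" by (rule fin_digraph_de_bruijn[OF fin])
  have "in_degree (de_bruijn A) v = out_degree (de_bruijn A) v" for v
    using bal[of v] by (simp add: in_degree_def out_degree_def in_arcs_def out_arcs_def)
  then obtain u p where "euler_trail u p u"
    using closed_euler1[OF conn] by blast
  then have cas: "cas u p u" and dist: "distinct p" and set_p: "set p = A"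
    by (auto simp: euler_trail_def trail_def awalk_def)
  define m where "m = length p"
  have m: "card A = m" using dist set_p distinct_card by (auto simp: m_def)
  have p: "p \<noteq> []" using set_p A(2) by auto
  have m0: "0 < m" using p by (simp add: m_def)
  have pA: "p ! (i mod m) \<in> A" for i
    using set_p m0 by (metis m_def mod_less_divisor nth_mem)
  have len: "length (p ! (i mod m)) = Suc n" for i
    using pA[of i] A(1) by (auto simp: tuples_def)
  have next_arc: "tl (p ! (i mod m)) = butlast (p ! (Suc i mod m))" for i
  proof (cases "Suc (i mod m) < m")
    case True
    then have "Suc i mod m = Suc (i mod m)" by (simp add: mod_Suc)
    then show ?thesis using cas_nth[OF cas, of "i mod m"] True by (simp add: m_def)
  next
    case False
    then have "Suc (i mod m) = m" using m0 mod_less_divisor[of m i] by linarith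
    then have "i mod m = m - 1" "Suc i mod m = 0"
      by (auto simp: mod_Suc)
    then have "Suc i mod m = 0" "p ! (i mod m) = last p"
      using p by (simp_all add: last_conv_nth m_def)
    then show ?thesis using cas_hd_last[OF cas p] p by (simp add: hd_conv_nth)
  qed
  define S where "S i = hd (p ! (i mod m))" for i
  \<comment> \<open>Each step to the next arc moves an entry one place to the left, until it is at the head.\<close>
  have nth: "j \<le> n \<Longrightarrow> p ! (i mod m) ! j = S (i + j)" for i j
  proof (induction j arbitrary: i)
    case 0
    then show ?case using len[of i] by (cases "p ! (i mod m)") (auto simp: S_def)
  next
    case (Suc j)
    have "p ! (i mod m) ! Suc j = tl (p ! (i mod m)) ! j"
      using len[of i] Suc.prems by (simp add: nth_tl)
    also have "\<dots> = p ! (Suc i mod m) ! j"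
      using next_arc[of i] len[of "Suc i"] Suc.prems by (simp add: nth_butlast)
    finally show ?case using Suc by simp
  qed
  have window: "window S (n + 1) i = p ! (i mod m)" for i
    using len[of i] nth[of _ i] by (auto simp: window_def list_eq_iff_nth_eq simp del: upt_Suc)
  have "S i < k" for i
    using pA[of i] len[of i] A(1) by (cases "p ! (i mod m)") (auto simp: S_def tuples_def)
  then have "periodic_seq k S m"
    using m0 by (auto simp: periodic_seq_def S_def)
  moreover have "[i = j] (mod m)" if "window S (n + 1) i = window S (n + 1) j" for i j
    using that dist m0 unfolding window cong_def by (subst (asm) nth_eq_iff_index_eq) (auto simp: m_def)
  ultimately have "window_sequence k (n + 1) S m"
    using n by (auto simp: window_sequence_def)
  then show ?thesis using m window pA by (intro exI[of _ S]) auto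
qed

section \<open>The graph of light differences\<close>

definition light_arcs :: "nat \<Rightarrow> nat \<Rightarrow> nat list set" where
  "light_arcs k n = {x \<in> tuples k (Suc n). differences k x \<in> light_tuples k n}"

lemma light_arcs_altdef:
  "light_arcs k n = {x \<in> tuples k (Suc n).
     pseudoweight k (differences k x) < of_nat n * of_nat k / 2}"
  by (auto simp: light_arcs_def light_tuples_def intro: differences_in_tuples)

lemma card_light_arcs: "card (light_arcs k n) = k * card (light_tuples k n)"
proof -
  have "{u \<in> tuples k n. u \<in> light_tuples k n} = light_tuples k n"
    by (auto simp: light_tuples_def)
  then show ?thesis
    using card_tuples_differences[of k n "\<lambda>u. u \<in> light_tuples k n"] by (simp add: light_arcs_def)
qed

text \<open>The differences of \<open>x\<close> and of its reverse have pseudoweights that add up to \<open>nk\<close>, so they cannot both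
  be below \<open>nk/2\<close>. In particular no palindrome is an arc.\<close>

lemma rev_notin_light_arcs:
  assumes "x \<in> light_arcs k n" shows "rev x \<notin> light_arcs k n"
proof -
  have x: "set x \<subseteq> {..<k}" and d: "length (differences k x) = n" "set (differences k x) \<subseteq> {..<k}"
    using assms differences_in_tuples[of x k n] by (auto simp: light_arcs_def tuples_def)
  have "pseudoweight k (differences k (rev x))
      = of_nat n * of_nat k - pseudoweight k (differences k x)"
    using d pseudoweight_neg[of "rev (differences k x)" k] by (simp add: differences_rev[OF x])
  then show ?thesis using assms by (auto simp: light_arcs_altdef mult.commute)
qed

text \<open>Whether a one-entry extension of \<open>v\<close> is an arc depends only on the one new difference \<open>d\<close>, by the
  same condition \<open>Q d\<close> at both ends of \<open>v\<close>; and every \<open>d\<close> arises from exactly one new entry.\<close>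

lemma light_arcs_balanced:
  assumes n: "0 < n"
  shows "card {x \<in> light_arcs k n. tl x = v} = card {x \<in> light_arcs k n. butlast x = v}"
proof (cases "v \<in> tuples k n")
  case False
  have "tl x \<in> tuples k n" "butlast x \<in> tuples k n" if "x \<in> light_arcs k n" for x
    using that by (auto simp: light_arcs_def intro: tl_in_tuples butlast_in_tuples)
  with False have "{x \<in> light_arcs k n. tl x = v} = {}" "{x \<in> light_arcs k n. butlast x = v} = {}"
    by blast+
  then show ?thesis by (simp only:)
next
  case True
  define Q where "Q d \<longleftrightarrow> pseudoval k d + pseudoweight k (differences k v) < of_nat n * of_nat k / 2" for d
  have v: "v \<noteq> []" "hd v < k" "last v < k" "length v = n" "set v \<subseteq> {..<k}"
    using True n hd_tuple_less[OF True n] last_tuple_less[OF True n] by (auto simp: tuples_def)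
  have "{x \<in> light_arcs k n. tl x = v} = (\<lambda>c. c # v) ` {c \<in> {..<k}. Q (diff_mod k c (hd v))}"
  proof (intro equalityI subsetI)
    fix x assume "x \<in> {x \<in> light_arcs k n. tl x = v}"
    then show "x \<in> (\<lambda>c. c # v) ` {c \<in> {..<k}. Q (diff_mod k c (hd v))}"
      using v by (cases x) (auto simp: light_arcs_altdef tuples_def differences_Cons Q_def)
  next
    fix x assume "x \<in> (\<lambda>c. c # v) ` {c \<in> {..<k}. Q (diff_mod k c (hd v))}"
    then show "x \<in> {x \<in> light_arcs k n. tl x = v}"
      using v by (auto simp: light_arcs_altdef tuples_def differences_Cons Q_def)
  qed
  then have "card {x \<in> light_arcs k n. tl x = v} = card {c \<in> {..<k}. Q (diff_mod k c (hd v))}"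
    by (simp add: card_image inj_on_def)
  also have "\<dots> = card {d \<in> {..<k}. Q d}"
    by (intro bij_betw_same_card[OF bij_betw_Collect[OF bij_betw_diff_mod_left[OF v(2)]]]) simp
  also have "\<dots> = card {c \<in> {..<k}. Q (diff_mod k (last v) c)}"
    by (intro bij_betw_same_card[OF bij_betw_Collect[OF bij_betw_diff_mod_right[OF v(3)]], symmetric]) simp
  also have "\<dots> = card {x \<in> light_arcs k n. butlast x = v}"
  proof -
    have "{x \<in> light_arcs k n. butlast x = v}
        = (\<lambda>c. v @ [c]) ` {c \<in> {..<k}. Q (diff_mod k (last v) c)}"
    proof (intro equalityI subsetI)
      fix x assume "x \<in> {x \<in> light_arcs k n. butlast x = v}"
      then show "x \<in> (\<lambda>c. v @ [c]) ` {c \<in> {..<k}. Q (diff_mod k (last v) c)}"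
        using v by (cases x rule: rev_cases)
          (auto simp: light_arcs_altdef tuples_def differences_snoc Q_def add.commute)
    next
      fix x assume "x \<in> (\<lambda>c. v @ [c]) ` {c \<in> {..<k}. Q (diff_mod k (last v) c)}"
      then show "x \<in> {x \<in> light_arcs k n. butlast x = v}"
        using v by (auto simp: light_arcs_altdef tuples_def differences_snoc Q_def add.commute)
    qed
    then show ?thesis by (simp add: card_image inj_on_def)
  qed
  finally show ?thesis .
qed

text \<open>The walk that shows connectedness: from the vertex \<open>v\<close> it takes the arc that adds the difference
  \<open>1\<close> at the end.\<close>

definition ramp_step :: "nat \<Rightarrow> nat list \<Rightarrow> nat list" where
  "ramp_step k v = tl v @ [Suc (last v) mod k]"

definition ramp_arc :: "nat \<Rightarrow> nat list \<Rightarrow> nat list" where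
  "ramp_arc k v = v @ [Suc (last v) mod k]"

lemma funpow_ramp_step:
  assumes "v \<noteq> []"
  shows "(ramp_step k ^^ j) v = drop j (v @ map (\<lambda>i. (last v + Suc i) mod k) [0..<j])"
proof (induction j)
  case (Suc j)
  let ?w = "v @ map (\<lambda>i. (last v + Suc i) mod k) [0..<j]"
  have "Suc (last (drop j ?w)) mod k = (last v + Suc j) mod k"
  proof -
    have "last (drop j ?w) = last ?w" using assms by (intro last_drop) (auto simp: Suc_le_eq)
    then show ?thesis by (cases j) (auto simp: mod_Suc_eq)
  qed
  moreover have "tl (drop j ?w) = drop (Suc j) ?w" by (simp only: drop_Suc tl_drop)
  moreover have "Suc j \<le> length ?w" using assms by (cases v) auto
  ultimately show ?case using Suc by (simp add: ramp_step_def)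
qed simp

text \<open>Once at least \<open>n\<close> entries have been appended, the vertex is a run of consecutive residues which
  depends only on its last entry. The number of steps is \<open>- last v\<close> modulo \<open>k\<close>, which makes this last
  entry \<open>0\<close>, enlarged by a multiple of \<open>k\<close> so that it is at least \<open>n\<close>.\<close>

lemma funpow_ramp_step_common:
  assumes v: "v \<in> tuples k n" and n: "0 < n"
  shows "(ramp_step k ^^ (n * k + k - last v)) v
    = map (\<lambda>t. (n * k + k + Suc t - n) mod k) [0..<n]"
proof -
  have vn: "v \<noteq> []" "length v = n" using v n by (auto simp: tuples_def)
  have last: "last v < k" using v n by (rule last_tuple_less)
  define j where "j = n * k + k - last v"
  have nk: "n \<le> n * k" using last by simp
  with last have j: "n \<le> j" "last v + j = n * k + k" unfolding j_def by linarith+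
  have "(ramp_step k ^^ j) v = map (\<lambda>t. (n * k + k + Suc t - n) mod k) [0..<n]"
  proof (rule nth_equalityI)
    show "length ((ramp_step k ^^ j) v) = length (map (\<lambda>t. (n * k + k + Suc t - n) mod k) [0..<n])"
      using vn by (simp add: funpow_ramp_step)
    fix t assume "t < length ((ramp_step k ^^ j) v)"
    then have t: "t < n" using vn by (simp add: funpow_ramp_step)
    have "[0..<j] ! (j + t - n) = j + t - n"
      using t j(1) by (subst nth_upt) auto
    then have "(ramp_step k ^^ j) v ! t = (last v + Suc (j + t - n)) mod k"
      using t j vn by (simp add: funpow_ramp_step nth_append)
    also have "last v + Suc (j + t - n) = n * k + k + Suc t - n"
      using j by simp
    finally show "(ramp_step k ^^ j) v ! t = map (\<lambda>t. (n * k + k + Suc t - n) mod k) [0..<n] ! t"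
      using t by simp
  qed
  then show ?thesis by (simp add: j_def)
qed

text \<open>A vertex is an arc without its first or its last entry. Restoring the dropped entry costs the
  pseudoweight of some difference \<open>d\<close>, and the difference \<open>1\<close> costs no more than \<open>d\<close>.\<close>

lemma ramp_arc_of_vertex:
  assumes k: "2 \<le> k" and n: "0 < n" and v: "v \<in> verts (de_bruijn (light_arcs k n))"
  shows "ramp_arc k v \<in> light_arcs k n"
proof -
  have *: "ramp_arc k v \<in> light_arcs k n"
    if "v \<in> tuples k n" "pseudoval k d + pseudoweight k (differences k v) < of_nat n * of_nat k / 2" for d
  proof -
    have "v \<noteq> []" "last v < k"
      using that(1) n last_tuple_less by (auto simp: tuples_def)
    then have "differences k (ramp_arc k v) = differences k v @ [1]"
      using k by (simp add: ramp_arc_def differences_snoc diff_mod_Suc)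
    moreover have "ramp_arc k v \<in> tuples k (Suc n)"
      using that(1) k by (auto simp: ramp_arc_def tuples_def)
    ultimately show ?thesis
      using that(2) pseudoval_1_le[OF k, of d] by (auto simp: light_arcs_altdef)
  qed
  from v obtain x where x: "x \<in> light_arcs k n" "v = butlast x \<or> v = tl x" by auto
  from x(2) show ?thesis
  proof
    assume v: "v = butlast x"
    then have xv: "x = v @ [last x]"
      using x(1) by (auto simp: light_arcs_def tuples_def intro!: append_butlast_last_id[symmetric])
    have "v \<in> tuples k n"
      using v x(1) by (auto simp: light_arcs_def intro: butlast_in_tuples)
    moreover have "differences k x = differences k v @ [diff_mod k (last v) (last x)]"
      using \<open>v \<in> tuples k n\<close> n by (subst xv, intro differences_snoc) (auto simp: tuples_def)
    ultimately show ?thesis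
      using x(1) *[of "diff_mod k (last v) (last x)"] by (auto simp: light_arcs_altdef add.commute)
  next
    assume v: "v = tl x"
    then obtain c where xv: "x = c # v"
      using x(1) by (cases x) (auto simp: light_arcs_def tuples_def)
    have "v \<in> tuples k n"
      using v x(1) by (auto simp: light_arcs_def intro: tl_in_tuples)
    moreover have "differences k x = diff_mod k c (hd v) # differences k v"
      using \<open>v \<in> tuples k n\<close> n by (subst xv, intro differences_Cons) (auto simp: tuples_def)
    ultimately show ?thesis
      using x(1) *[of "diff_mod k c (hd v)"] by (auto simp: light_arcs_altdef)
  qed
qed

lemma ramp_arc_ends:
  assumes "v \<noteq> []"
  shows "butlast (ramp_arc k v) = v" "tl (ramp_arc k v) = ramp_step k v"
  using assms by (auto simp: ramp_arc_def ramp_step_def)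

text \<open>The tuple \<open>0, 1, 2, \<dots>\<close> modulo \<open>k\<close> has all differences \<open>1\<close>, so their pseudoweight is \<open>n\<close>, which is
  less than \<open>nk/2\<close> when \<open>k \<ge> 3\<close>.\<close>

lemma light_arcs_nonempty:
  assumes k: "3 \<le> k" and n: "0 < n"
  shows "light_arcs k n \<noteq> {}"
proof -
  define x where "x = map (\<lambda>i. i mod k) [0..<Suc n]"
  have "differences k (map (\<lambda>i. i mod k) [0..<Suc j]) = replicate j 1" for j
  proof (induction j)
    case (Suc j)
    have "differences k (map (\<lambda>i. i mod k) [0..<Suc (Suc j)])
        = differences k (map (\<lambda>i. i mod k) [0..<Suc j] @ [Suc j mod k])" by simp
    also have "\<dots> = replicate j 1 @ [diff_mod k (j mod k) (Suc (j mod k) mod k)]"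
      using Suc by (subst differences_snoc) (auto simp: mod_Suc_eq)
    also have "\<dots> = replicate (Suc j) 1"
      using k by (simp add: diff_mod_Suc replicate_append_same)
    finally show ?case .
  qed simp
  then have "pseudoweight k (differences k x) = of_nat n"
    by (simp add: x_def pseudoweight_def pseudoval_def sum_list_replicate)
  moreover have "(of_nat n :: rat) < of_nat n * of_nat k / 2"
    using k n by simp
  moreover have "x \<in> tuples k (Suc n)"
    using k by (auto simp: x_def tuples_def)
  ultimately show ?thesis by (auto simp: light_arcs_altdef)
qed

text \<open>All vertices reach one common vertex by ramp steps; weak connectedness, which is all that an
  Eulerian circuit in a balanced digraph requires, follows by walking back along the second path.\<close>

lemma light_arcs_connected:
  assumes k: "3 \<le> k" and n: "0 < n"
  shows "connected (de_bruijn (light_arcs k n))"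
proof -
  let ?G = "de_bruijn (light_arcs k n)"
  have fin: "finite (light_arcs k n)"
    using finite_tuples by (simp add: light_arcs_def)
  interpret fin_digraph ?G by (rule fin_digraph_de_bruijn[OF fin])
  have tup: "v \<in> tuples k n" if "v \<in> verts ?G" for v
  proof -
    have "ramp_arc k v \<in> tuples k (Suc n)"
      using ramp_arc_of_vertex[of k n v] that k n by (auto simp: light_arcs_def)
    then show ?thesis by (auto simp: ramp_arc_def tuples_def)
  qed
  have step: "v \<rightarrow>\<^bsub>?G\<^esub> ramp_step k v" if "v \<in> verts ?G" for v
  proof -
    have "v \<noteq> []" using tup[OF that] n by (auto simp: tuples_def)
    moreover have "ramp_arc k v \<in> light_arcs k n"
      using ramp_arc_of_vertex[of k n v] that k n by auto
    ultimately show ?thesis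
      by (force simp: arcs_ends_conv ramp_arc_ends)
  qed
  have steps: "v \<rightarrow>\<^sup>*\<^bsub>?G\<^esub> (ramp_step k ^^ j) v" if "v \<in> verts ?G" for v j
  proof (induction j)
    case 0
    then show ?case using that by (simp add: reachable_refl del: de_bruijn_simps)
  next
    case (Suc j)
    then have "(ramp_step k ^^ j) v \<in> verts ?G" by (rule reachable_in_vertsE)
    from step[OF this] Suc show ?case by (simp add: reachable_adj_trans del: de_bruijn_simps)
  qed
  define r where "r = map (\<lambda>t. (n * k + k + Suc t - n) mod k) [0..<n]"
  interpret S: pair_wf_digraph "mk_symmetric ?G" by rule
  have sym: "symmetric (mk_symmetric ?G)" by (rule symmetric_mk_symmetric)
  have to_r: "v \<rightarrow>\<^sup>*\<^bsub>mk_symmetric ?G\<^esub> r" if "v \<in> verts ?G" for v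
    using steps[OF that, of "n * k + k - last v"] funpow_ramp_step_common[OF tup[OF that] n]
    by (intro reachable_mk_symmetricI) (simp add: r_def)
  show ?thesis
    unfolding connected_def
  proof (rule strongly_connectedI)
    show "verts (mk_symmetric ?G) \<noteq> {}"
      using light_arcs_nonempty[OF k n] by simp
    fix u v assume "u \<in> verts (mk_symmetric ?G)" "v \<in> verts (mk_symmetric ?G)"
    then have "u \<rightarrow>\<^sup>*\<^bsub>mk_symmetric ?G\<^esub> r" "v \<rightarrow>\<^sup>*\<^bsub>mk_symmetric ?G\<^esub> r"
      using to_r by auto
    then show "u \<rightarrow>\<^sup>*\<^bsub>mk_symmetric ?G\<^esub> v"
      using symmetric_reachable[OF sym] S.reachable_trans by blast
  qed
qed

section \<open>Orientable sequences\<close>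

theorem corollary5p12:
  fixes k n :: nat
  assumes "k \<ge> 3" and "n \<ge> 2"
  shows "\<exists>S m. orientable_sequence k (n + 1) S m \<and>
           (of_nat m :: rat) =
             of_nat k * ((of_nat k ^ n - of_nat (pseudoweight_count k n (of_nat n * of_nat k / 2))) / 2)"
proof -
  let ?A = "light_arcs k n" and ?r = "pseudoweight_count k n (of_nat n * of_nat k / 2)"
  have n: "0 < n" using assms by simp
  obtain S where S: "window_sequence k (n + 1) S (card ?A)" "range (window S (n + 1)) \<subseteq> ?A"
    using window_sequence_from_euler[of ?A k n] light_arcs_nonempty light_arcs_connected
      light_arcs_balanced assms n by (auto simp: light_arcs_def)
  have "window S (n + 1) i \<noteq> rev (window S (n + 1) j)" for i j
    using S(2) rev_notin_light_arcs[of "window S (n + 1) j" k n] by (metis range_subsetD)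
  with S(1) have "orientable_sequence k (n + 1) S (card ?A)"
    by (simp add: orientable_sequence_def)
  moreover have "(of_nat (card ?A) :: rat) = of_nat k * ((of_nat k ^ n - of_nat ?r) / 2)"
  proof -
    have "(of_nat (2 * card (light_tuples k n) + ?r) :: rat) = of_nat (k ^ n)"
      by (simp only: card_light_tuples)
    then have "(of_nat (card (light_tuples k n)) :: rat) = (of_nat k ^ n - of_nat ?r) / 2"
      by simp
    then show ?thesis by (simp add: card_light_arcs)
  qed
  ultimately show ?thesis by blast
qed

end
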